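(* Let $P$ be a nonempty set of prime numbers, and let $M = \langle 1/p \mid p \in P \rangle$ be the additive submonoid of $\mathbb{Q}_{\ge 0}$ generated by the reciprocals of the elements of $P$. Then the positive semiring $E(M)$ satisfies the bi-ACCP.
   Context: For an additive submonoid $M$ of $\mathbb{R}_{\ge 0}$ consisting of algebraic numbers, $E(M) := \langle e^m \mid m \in M \rangle$ is the additive submonoid of $\mathbb{R}_{\ge 0}$ generated by the real numbers $e^m$ with $m \in M$, i.e. the set of all finite sums of such numbers (including $0$); it is closed under multiplication and contains $1 = e^0$, so it is a positive semiring (a subset of $\mathbb{R}_{\ge 0}$ containing $0$ and $1$ and closed under the usual addition and multiplication). A monoid is a cancellative commutative semigroup with identity. A monoid $(M,* )$ satisfies the ACCP if every ascending chain (under inclusion) of principal ideals $x * M = \{x * y \mid y \in M\}$, $x \in M$, stabilizes. A positive semiring $S$ satisfies the bi-ACCP if both its additive monoid $(S,+)$ and its multiplicative monoid $(S \setminus \{0\}, \cdot)$ satisfy the ACCP. *)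

theory Defs
  imports Complex_Main "HOL-Algebra.Divisibility" "HOL-Computational_Algebra.Primes"
begin

inductive_set add_submonoid_gen :: "'a::comm_monoid_add set \<Rightarrow> 'a set"
  for A :: "'a set"
where
  zero: "0 \<in> add_submonoid_gen A"
| incl: "a \<in> A \<Longrightarrow> a \<in> add_submonoid_gen A"
| add: "x \<in> add_submonoid_gen A \<Longrightarrow> y \<in> add_submonoid_gen A \<Longrightarrow> x + y \<in> add_submonoid_gen A"

definition exp_semiring :: "real set \<Rightarrow> real set" where
  "exp_semiring M = add_submonoid_gen (exp ` M)"

definition principal_ideal :: "('a, 'b) monoid_scheme \<Rightarrow> 'a \<Rightarrow> 'a set" where
  "principal_ideal G x = {x \<otimes>\<^bsub>G\<^esub> y | y. y \<in> carrier G}"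

definition ACCP :: "('a, 'b) monoid_scheme \<Rightarrow> bool" where
  "ACCP G \<longleftrightarrow>
     (\<forall>I :: nat \<Rightarrow> 'a set.
        (\<forall>n. \<exists>x \<in> carrier G. I n = principal_ideal G x) \<longrightarrow>
        (\<forall>n. I n \<subseteq> I (Suc n)) \<longrightarrow>
        (\<exists>N. \<forall>n \<ge> N. I n = I N))"

definition positive_semiring :: "real set \<Rightarrow> bool" where
  "positive_semiring S \<longleftrightarrow>
     (\<forall>x \<in> S. 0 \<le> x) \<and> 0 \<in> S \<and> 1 \<in> S \<and>
     (\<forall>x \<in> S. \<forall>y \<in> S. x + y \<in> S) \<and> (\<forall>x \<in> S. \<forall>y \<in> S. x * y \<in> S)"

definition additive_monoid :: "real set \<Rightarrow> real monoid" where
  "additive_monoid S = \<lparr>carrier = S, mult = (+), one = 0\<rparr>"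

definition multiplicative_monoid :: "real set \<Rightarrow> real monoid" where
  "multiplicative_monoid S = \<lparr>carrier = S - {0}, mult = (*), one = 1\<rparr>"

definition bi_ACCP :: "real set \<Rightarrow> bool" where
  "bi_ACCP S \<longleftrightarrow> ACCP (additive_monoid S) \<and> ACCP (multiplicative_monoid S)"

lemma comm_monoid_cancel_additive_monoid:
  assumes "positive_semiring S"
  shows "comm_monoid_cancel (additive_monoid S)"
  using assms
  by (unfold_locales) (auto simp: positive_semiring_def additive_monoid_def)

lemma comm_monoid_cancel_multiplicative_monoid:
  assumes "positive_semiring S"
  shows "comm_monoid_cancel (multiplicative_monoid S)"
  using assms
  by (unfold_locales) (auto simp: positive_semiring_def multiplicative_monoid_def)

lemma add_submonoid_gen_nonneg:
  fixes A :: "'a::ordered_comm_monoid_add set"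
  assumes "x \<in> add_submonoid_gen A" and "\<forall>a \<in> A. 0 \<le> a"
  shows "0 \<le> x"
  using assms by (induction rule: add_submonoid_gen.induct) auto

lemma positive_semiring_exp_semiring:
  assumes "0 \<in> M" and plus: "\<And>x y. x \<in> M \<Longrightarrow> y \<in> M \<Longrightarrow> x + y \<in> M"
  shows "positive_semiring (exp_semiring M)"
proof -
  let ?G = "add_submonoid_gen (exp ` M)"
  have scale: "exp m * y \<in> ?G" if "y \<in> ?G" and "m \<in> M" for m y
    using that
  proof (induction rule: add_submonoid_gen.induct)
    case (incl a)
    then show ?case
      by (metis add_submonoid_gen.incl exp_add image_iff plus)
  qed (auto simp: distrib_left intro: add_submonoid_gen.intros)
  have mult: "x * y \<in> ?G" if "x \<in> ?G" and "y \<in> ?G" for x y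
    using that
    by (induction rule: add_submonoid_gen.induct)
       (auto simp: distrib_right intro: add_submonoid_gen.intros scale)
  have "1 \<in> ?G"
    using assms(1) by (metis add_submonoid_gen.incl exp_zero image_eqI)
  then show ?thesis
    unfolding positive_semiring_def exp_semiring_def
    by (auto intro: mult add_submonoid_gen.intros add_submonoid_gen_nonneg)
qed

end

theory Submission
  imports Defs "HOL-Computational_Algebra.Polynomial" "HOL-Library.Multiset"
begin

text \<open>
  Every nonzero element of the semiring is at least 1, and it is at least 2 unless it is a single
  exponential. Hence an additive chain starting at \<open>x\<close> has at most \<open>x\<close> nontrivial steps, and in a
  multiplicative chain all quotients are eventually of the form \<open>exp m\<close> with \<open>m \<in> M\<close>. By the
  transcendence of \<open>exp (1 / N)\<close>, a finite sum of exponentials with rational exponents determines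
  the multiset of its exponents, so the division by \<open>exp m\<close> subtracts \<open>m\<close> from every exponent, and
  the sums of the exponents form a divisibility chain in \<open>M\<close>. Finally \<open>M\<close> satisfies the ACCP:
  an element \<open>\<Sum> n\<^sub>p / p\<close> determines \<open>\<Sum> (n\<^sub>p div p)\<close> and all \<open>n\<^sub>p mod p\<close>, and
  the pair \<open>(\<Sum> (n\<^sub>p div p), \<Sum> (n\<^sub>p mod p))\<close> decreases lexicographically along proper divisors.
\<close>

section \<open>Transcendence of \<open>exp (1 / N)\<close>\<close>

abbreviation real_poly :: "int poly \<Rightarrow> real poly" where
  "real_poly \<equiv> map_poly real_of_int"

lemma pderiv_real_poly: "pderiv (real_poly q) = real_poly (pderiv q)"
  by (rule poly_eqI) (simp add: coeff_map_poly coeff_pderiv)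

lemma poly_real_poly_of_int: "poly (real_poly q) (real_of_int k) = real_of_int (poly q k)"
  by (induction q) (simp_all add: map_poly_pCons)

lemma real_poly_diff: "real_poly (q - r) = real_poly q - real_poly r"
  by (rule poly_eqI) (simp add: coeff_map_poly)

lemma real_poly_smult: "real_poly (smult c q) = smult (real_of_int c) (real_poly q)"
  by (rule poly_eqI) (simp add: coeff_map_poly)

lemma real_poly_mult: "real_poly (q * r) = real_poly q * real_poly r"
  by (rule poly_eqI) (simp add: coeff_map_poly coeff_mult)

lemma real_poly_power: "real_poly (q ^ n) = real_poly q ^ n"
  by (induction n) (simp_all add: real_poly_mult)

lemma real_poly_prod: "real_poly (prod f I) = (\<Prod>i\<in>I. real_poly (f i))"
  by (induction I rule: infinite_finite_induct) (simp_all add: real_poly_mult)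

text \<open>
  For \<open>F = hermite_sum N L g\<close> with \<open>L \<ge> degree g\<close>, the derivative of \<open>exp (- x / N) * F x\<close> is
  \<open>- exp (- x / N) * g x / N\<close>; the weights \<open>N ^ j\<close> adapt Hermite's construction for \<open>exp 1\<close> to
  \<open>exp (1 / N)\<close> while keeping \<open>F\<close> integral.
\<close>

definition hermite_sum :: "int \<Rightarrow> nat \<Rightarrow> int poly \<Rightarrow> int poly" where
  "hermite_sum N L g = (\<Sum>j\<le>L. smult (N ^ j) ((pderiv ^^ j) g))"

text \<open>Multiplying by \<open>N\<close> and differentiating turns the \<open>j\<close>-th
  summand into the \<open>j + 1\<close>-st, so in the difference only the first summand and the
  image of the last one survive. The latter vanishes as soon as
  \<open>L \<ge> degree g\<close>.\<close>

lemma hermite_sum_telescope: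
  "hermite_sum N L g - smult N (pderiv (hermite_sum N L g))
     = g - smult (N ^ Suc L) ((pderiv ^^ Suc L) g)"
proof (induction L)
  case (Suc L)
  let ?t = "smult (N ^ Suc L) ((pderiv ^^ Suc L) g)"
  have "hermite_sum N (Suc L) g = hermite_sum N L g + ?t"
    by (simp add: hermite_sum_def)
  then have "hermite_sum N (Suc L) g - smult N (pderiv (hermite_sum N (Suc L) g))
      = (hermite_sum N L g - smult N (pderiv (hermite_sum N L g))) + (?t - smult N (pderiv ?t))"
    by (simp add: pderiv_add smult_add_right)
  then show ?case unfolding Suc.IH by (simp add: pderiv_smult)
qed (simp add: hermite_sum_def)

lemma higher_pderiv_eq_0:
  fixes g :: "int poly"
  assumes "degree g < j"
  shows "(pderiv ^^ j) g = 0"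
  using assms by (intro poly_eqI) (simp add: coeff_higher_pderiv coeff_eq_0)

lemma hermite_sum_pderiv:
  assumes "degree g \<le> L"
  shows "hermite_sum N L g - smult N (pderiv (hermite_sum N L g)) = g"
  using assms higher_pderiv_eq_0[of g "Suc L"] by (simp add: hermite_sum_telescope del: funpow.simps)

text \<open>This is the mean value theorem for \<open>exp (- x / N) * F x\<close> on the interval
  from 0 to \<open>k\<close>, multiplied by \<open>exp (k / N)\<close>: the values of
  \<open>F\<close> at 0 and at \<open>k\<close> have almost the ratio
  \<open>exp (k / N)\<close>.\<close>

lemma hermite_sum_bound:
  fixes N :: nat and B :: real
  assumes N: "0 < N" and L: "degree g \<le> L"
    and B: "\<And>x. 0 \<le> x \<Longrightarrow> x \<le> real k \<Longrightarrow> \<bar>poly (real_poly g) x\<bar> \<le> B"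
  defines "F \<equiv> hermite_sum (int N) L g"
  shows "\<bar>real_of_int (poly F (int k)) - exp (real k / real N) * real_of_int (poly F 0)\<bar>
           \<le> exp (real k / real N) * real k * B"
proof -
  define R where "R = real_poly F"
  have g: "R - smult (real N) (pderiv R) = real_poly g"
    using hermite_sum_pderiv[OF L, of "int N"]
      real_poly_smult[of "int N" "pderiv F"] real_poly_diff[of F "smult (int N) (pderiv F)"]
    by (simp add: R_def F_def pderiv_real_poly)
  define G where "G = (\<lambda>x. exp (- x / real N) * poly R x)"
  have deriv: "(G has_real_derivative - (exp (- x / real N) / real N * poly (real_poly g) x)) (at x)" for x
    unfolding G_def g[symmetric] using N
    by (auto intro!: derivative_eq_intros simp: field_simps)
  have G: "\<bar>G (real k) - G 0\<bar> \<le> real k * B"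
  proof (cases "k = 0")
    case False
    then obtain z where z: "0 < z" "z < real k"
      and eq: "G (real k) - G 0 = (real k - 0) * - (exp (- z / real N) / real N * poly (real_poly g) z)"
      using MVT2[of 0 "real k" G, OF _ deriv] by auto
    have "exp (- z / real N) \<le> 1"
      using z N by simp
    also have "1 \<le> real N" using N by simp
    finally have "exp (- z / real N) / real N \<le> 1"
      using N by simp
    then have "\<bar>exp (- z / real N) / real N * poly (real_poly g) z\<bar> \<le> 1 * B"
      unfolding abs_mult using B[of z] z by (intro mult_mono) auto
    then show ?thesis unfolding eq by (metis abs_minus abs_mult abs_of_nat diff_zero mult_1 mult_left_mono of_nat_0_le_iff)
  qed simp
  have "real_of_int (poly F (int k)) - exp (real k / real N) * real_of_int (poly F 0)
      = exp (real k / real N) * (G (real k) - G 0)"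
    using poly_real_poly_of_int[of F "int k"] poly_real_poly_of_int[of F 0]
    by (simp add: G_def R_def algebra_simps exp_minus)
  then show ?thesis using G by (simp add: abs_mult mult.assoc)
qed

section \<open>Divisibility of values of Hermite sums by factorials\<close>

lemma poly_higher_pderiv_0:
  fixes q :: "int poly"
  shows "poly ((pderiv ^^ j) q) 0 = fact j * coeff q j"
  by (simp add: poly_0_coeff_0 coeff_higher_pderiv pochhammer_fact)

lemma pcompose_power: "pcompose (q ^ n) r = pcompose q r ^ n"
  for q r :: "int poly"
  by (induction n) (simp_all add: pcompose_mult pcompose_1)

lemma higher_pderiv_shift:
  fixes q :: "int poly"
  shows "(pderiv ^^ j) (pcompose q [:k, 1:]) = pcompose ((pderiv ^^ j) q) [:k, 1:]"
  by (induction j) (simp_all add: pderiv_pcompose pderiv_pCons)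

text \<open>Translation by \<open>k\<close> moves the root to 0. There the \<open>j\<close>-th
  derivative is \<open>fact j\<close> times the \<open>j\<close>-th coefficient, which vanishes for
  \<open>j < m\<close>, while \<open>fact m\<close> divides \<open>fact j\<close> for
  \<open>j \<ge> m\<close>.\<close>

lemma fact_dvd_poly_higher_pderiv:
  fixes h :: "int poly"
  shows "fact m dvd poly ((pderiv ^^ j) ([:- k, 1:] ^ m * h)) k"
proof -
  have "poly ((pderiv ^^ j) ([:- k, 1:] ^ m * h)) k
      = poly ((pderiv ^^ j) (pcompose ([:- k, 1:] ^ m * h) [:k, 1:])) 0"
    by (simp add: higher_pderiv_shift poly_pcompose)
  also have "pcompose ([:- k, 1:] ^ m * h) [:k, 1:] = monom 1 m * pcompose h [:k, 1:]"
    by (simp add: pcompose_mult pcompose_power pcompose_pCons monom_altdef)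
  also have "fact m dvd poly ((pderiv ^^ j) \<dots>) 0"
    by (auto simp: poly_higher_pderiv_0 coeff_monom_mult intro!: dvd_mult2 fact_dvd)
  finally show ?thesis .
qed

lemma fact_dvd_hermite_sum_root:
  "fact m dvd poly (hermite_sum N L ([:- k, 1:] ^ m * h)) k"
  by (auto simp: hermite_sum_def poly_sum intro!: dvd_sum dvd_mult fact_dvd_poly_higher_pderiv)

text \<open>Modulo \<open>fact (Suc m)\<close> only the summand \<open>j = m\<close> survives: for
  smaller \<open>j\<close> the coefficient is 0, for larger \<open>j\<close> the factor
  \<open>fact j\<close> is divisible by \<open>fact (Suc m)\<close>.\<close>

lemma fact_dvd_hermite_sum_0:
  assumes "m \<le> L"
  shows "fact (Suc m) dvd poly (hermite_sum N L (monom 1 m * h)) 0 - N ^ m * fact m * poly h 0"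
proof -
  let ?t = "\<lambda>j. N ^ j * (fact j * coeff (monom 1 m * h) j)"
  have "poly (hermite_sum N L (monom 1 m * h)) 0 = (\<Sum>j\<le>L. ?t j)"
    by (simp add: hermite_sum_def poly_sum poly_higher_pderiv_0)
  also have "\<dots> = ?t m + (\<Sum>j\<in>{..L} - {m}. ?t j)"
    using assms by (subst sum.remove[of _ m]) auto
  also have "?t m = N ^ m * fact m * poly h 0"
    by (simp add: coeff_monom_mult poly_0_coeff_0)
  finally have "poly (hermite_sum N L (monom 1 m * h)) 0 - N ^ m * fact m * poly h 0
      = (\<Sum>j\<in>{..L} - {m}. ?t j)" by simp
  also have "fact (Suc m) dvd \<dots>"
  proof (rule dvd_sum)
    fix j assume j: "j \<in> {..L} - {m}"
    show "fact (Suc m) dvd ?t j"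
    proof (cases "j < m")
      case False
      with j have "(fact (Suc m) :: int) dvd fact j" by (intro fact_dvd) auto
      then show ?thesis by (meson dvd_mult dvd_mult2)
    qed (simp add: coeff_monom_mult)
  qed
  finally show ?thesis .
qed

text \<open>Hermite's argument: a vanishing combination would make the integer \<open>S\<close>, the
  sum of the \<open>a k * poly F k\<close>, smaller than \<open>fact (p - 1)\<close> for a large
  prime \<open>p\<close>. But \<open>S\<close> is a nonzero multiple of \<open>fact (p - 1)\<close>,
  because it is one modulo \<open>fact p\<close> with a cofactor prime to \<open>p\<close>.\<close>

lemma exp_nat_multiples_independent:
  fixes a :: "nat \<Rightarrow> int" and N n :: nat
  assumes N: "0 < N" and a0: "a 0 \<noteq> 0"
  shows "(\<Sum>k\<le>n. real_of_int (a k) * exp (real k / real N)) \<noteq> 0"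
proof
  assume zero: "(\<Sum>k\<le>n. real_of_int (a k) * exp (real k / real N)) = 0"
  \<comment> \<open>On the interval from 0 to \<open>n\<close> each of the \<open>n + 1\<close>
    linear factors of \<open>g\<close> is at most \<open>n + 1\<close> in absolute value, so
    \<open>D ^ p\<close> bounds \<open>g\<close>. The constant \<open>C\<close> collects the
    remaining factors of the analytic estimate.\<close>
  define D where "D = real (Suc n) ^ Suc n"
  define C where "C = (\<Sum>k\<le>n. \<bar>real_of_int (a k)\<bar> * (exp (real k / real N) * real k))"
  have D1: "1 \<le> D" unfolding D_def by (rule one_le_power) simp
  have "(\<lambda>m. (C * D) * (inverse (fact m) * D ^ m)) \<longlonglongrightarrow> (C * D) * 0"
    by (intro tendsto_intros summable_LIMSEQ_zero summable_exp)
  then have "\<forall>\<^sub>F m in sequentially. (C * D) * (inverse (fact m) * D ^ m) < 1"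
    by (intro order_tendstoD) auto
  then obtain m0 where m0: "\<And>m. m \<ge> m0 \<Longrightarrow> (C * D) * (inverse (fact m) * D ^ m) < 1"
    by (auto simp: eventually_sequentially)
  \<comment> \<open>The size of \<open>p\<close> ensures that \<open>p\<close> divides neither
    \<open>a 0\<close> nor \<open>N\<close> nor any of 1, ..., \<open>n\<close>, and that
    \<open>p - 1 \<ge> m0\<close>, where the factorial already dominates.\<close>
  obtain p where p: "prime p" "p > m0 + n + N + nat \<bar>a 0\<bar>"
    using bigger_prime by blast
  define m where "m = p - 1"
  have pm: "p = Suc m" and "m \<ge> m0" using p by (simp_all add: m_def)
  define h :: "int poly" where "h = (\<Prod>k\<in>{1..n}. [:- int k, 1:] ^ p)"
  define g where "g = monom 1 m * h"
  \<comment> \<open>This choice makes both \<open>degree g \<le> L\<close> and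
    \<open>m \<le> L\<close> immediate.\<close>
  define L where "L = degree g + m"
  define F where "F = hermite_sum (int N) L g"

  have bound: "\<bar>poly (real_poly g) x\<bar> \<le> D ^ p" if x: "0 \<le> x" "x \<le> real n" for x
  proof -
    have "poly (real_poly g) x = x ^ m * (\<Prod>k\<in>{1..n}. (x - real k) ^ p)"
      by (simp add: g_def h_def real_poly_mult real_poly_prod real_poly_power poly_prod
          map_poly_monom poly_monom map_poly_pCons)
    also have "\<bar>\<dots>\<bar> = x ^ m * (\<Prod>k\<in>{1..n}. \<bar>x - real k\<bar> ^ p)"
      using x by (simp add: abs_mult abs_prod power_abs)
    also have "\<dots> \<le> real (Suc n) ^ m * (\<Prod>k\<in>{1..n}. real (Suc n) ^ p)"
      using x by (intro mult_mono power_mono prod_mono conjI prod_nonneg) auto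
    also have "\<dots> \<le> real (Suc n) ^ p * (\<Prod>k\<in>{1..n}. real (Suc n) ^ p)"
      by (intro mult_right_mono power_increasing prod_nonneg) (auto simp: pm)
    also have "\<dots> = D ^ p"
      by (simp add: D_def power_mult_distrib power_mult [symmetric] mult.commute)
    finally show ?thesis .
  qed
  have diff: "\<bar>real_of_int (poly F (int k)) - exp (real k / real N) * real_of_int (poly F 0)\<bar>
      \<le> exp (real k / real N) * real k * D ^ p" if "k \<le> n" for k
    unfolding F_def using that by (intro hermite_sum_bound N bound) (auto simp: L_def)

  have roots: "fact p dvd poly F (int k)" if "k \<in> {1..n}" for k
  proof -
    have "g = [:- int k, 1:] ^ p * (monom 1 m * (\<Prod>i\<in>{1..n} - {k}. [:- int i, 1:] ^ p))"
      using that unfolding g_def h_def by (subst prod.remove[of _ k]) (auto simp: mult.left_commute)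
    then show ?thesis unfolding F_def by (metis fact_dvd_hermite_sum_root)
  qed
  have at0: "fact p dvd poly F 0 - int N ^ m * fact m * poly h 0"
    unfolding F_def g_def pm by (rule fact_dvd_hermite_sum_0) (simp add: L_def)

  define S where "S = (\<Sum>k\<le>n. a k * poly F (int k))"
  define c where "c = a 0 * int N ^ m * poly h 0"
  have "{..n} = insert 0 {1..n}" by auto
  then have S: "S = a 0 * poly F 0 + (\<Sum>k\<in>{1..n}. a k * poly F (int k))"
    by (simp add: S_def)
  have "fact p dvd a 0 * (poly F 0 - int N ^ m * fact m * poly h 0)
      + (\<Sum>k\<in>{1..n}. a k * poly F (int k))"
    using at0 roots by (intro dvd_add dvd_sum dvd_mult) auto
  then have "fact p dvd S - fact m * c"
    by (simp add: S c_def algebra_simps)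
  then obtain z where "S - fact m * c = fact p * z" by auto
  then have Sz: "S = fact m * (c + int p * z)"
    by (simp add: pm algebra_simps)
  have ip: "prime (int p)" using p by simp
  have ndvd: "\<not> int p dvd b" if "b \<noteq> 0" "\<bar>b\<bar> < int p" for b :: int
    using that dvd_imp_le_int[of b "int p"] by auto
  have "\<not> int p dvd poly h 0"
  proof
    assume "int p dvd poly h 0"
    then obtain k where "k \<in> {1..n}" "int p dvd (- int k) ^ p"
      using ip by (auto simp: h_def poly_prod prime_dvd_prod_iff)
    then have "int p dvd int k" using prime_dvd_power[OF ip] dvd_minus_iff by blast
    then show False using ndvd[of "int k"] \<open>k \<in> {1..n}\<close> p by auto
  qed
  moreover have "\<not> int p dvd int N ^ m"
    using ndvd[of "int N"] N p prime_dvd_power[OF ip, of "int N" m] by auto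
  moreover have "\<not> int p dvd a 0" using ndvd[of "a 0"] a0 p by auto
  ultimately have "\<not> int p dvd c" unfolding c_def using ip by (simp add: prime_dvd_mult_iff)
  then have "c + int p * z \<noteq> 0" by (metis dvd_0_right dvd_add_left_iff dvd_triv_left)
  then have "1 \<le> \<bar>c + int p * z\<bar>" by linarith
  then have "fact m * 1 \<le> \<bar>S\<bar>"
    unfolding Sz abs_mult by (intro mult_mono) auto
  then have low: "fact m \<le> \<bar>real_of_int S\<bar>"
    by (metis mult.right_neutral of_int_abs of_int_fact of_int_le_iff)

  \<comment> \<open>Subtracting \<open>poly F 0\<close> times the vanishing combination leaves only
    the small differences bounded in \<open>diff\<close>.\<close>
  have "real_of_int S = (\<Sum>k\<le>n. real_of_int (a k) * real_of_int (poly F (int k)))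
      - real_of_int (poly F 0) * (\<Sum>k\<le>n. real_of_int (a k) * exp (real k / real N))"
    by (simp add: S_def zero)
  also have "\<dots> = (\<Sum>k\<le>n. real_of_int (a k) *
      (real_of_int (poly F (int k)) - exp (real k / real N) * real_of_int (poly F 0)))"
    by (simp add: sum_distrib_left sum_subtractf algebra_simps)
  also have "\<bar>\<dots>\<bar> \<le> (\<Sum>k\<le>n. \<bar>real_of_int (a k)\<bar> * (exp (real k / real N) * real k * D ^ p))"
    using diff by (intro order_trans[OF sum_abs] sum_mono) (auto simp: abs_mult intro!: mult_left_mono)
  also have "\<dots> = C * D ^ p" by (simp add: C_def sum_distrib_right mult.assoc)
  finally have "fact m \<le> C * D ^ p" using low by linarith
  moreover have "C * D ^ p < fact m"
    using m0[OF \<open>m \<ge> m0\<close>] by (simp add: pm field_simps)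
  ultimately show False by linarith
qed

text \<open>The induction strips factors \<open>X\<close>, which do not vanish at an exponential,
  until the constant coefficient is nonzero.\<close>

theorem exp_inverse_nat_transcendental:
  assumes N: "0 < N" and "q \<noteq> 0"
  shows "poly (real_poly q) (exp (1 / real N)) \<noteq> 0"
  using assms(2)
proof (induction q)
  case (pCons a q)
  show ?case
  proof (cases "a = 0")
    case True
    with pCons show ?thesis by (auto simp: map_poly_pCons)
  next
    case False
    let ?q = "pCons a q"
    have deg: "degree (real_poly ?q) = degree ?q"
      by (rule degree_map_poly) simp
    have "poly (real_poly ?q) (exp (1 / real N))
        = (\<Sum>k\<le>degree ?q. real_of_int (coeff ?q k) * exp (real k / real N))"
      unfolding poly_altdef deg
      by (simp add: coeff_map_poly exp_of_nat_mult [symmetric] del: degree_pCons_eq_if)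
    then show ?thesis
      using exp_nat_multiples_independent[OF N, of "coeff ?q"] False by simp
  qed
qed simp

section \<open>Sums of reciprocals of primes\<close>

text \<open>Multisets of primes represent the elements of the monoid. Representations are not
  unique: two halves and three thirds have the same sum.\<close>

definition recip_sum :: "nat multiset \<Rightarrow> rat" where
  "recip_sum A = (\<Sum>p\<in>#A. 1 / of_nat p)"

lemma recip_sum_add: "recip_sum (A + B) = recip_sum A + recip_sum B"
  by (simp add: recip_sum_def)

text \<open>Any finite \<open>F\<close> containing the support is allowed, so that different
  multisets can be compared over one index set.\<close>

lemma recip_sum_altdef:
  assumes "finite F" "set_mset A \<subseteq> F"
  shows "recip_sum A = (\<Sum>p\<in>F. of_nat (count A p) / of_nat p)"
  using assms(2)
proof (induction A)
  case (add x A)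
  have "(\<Sum>p\<in>F. of_nat (count (add_mset x A) p) / of_nat p :: rat)
      = (\<Sum>p\<in>F. of_nat (count A p) / of_nat p + (if p = x then 1 / of_nat p else 0))"
    by (intro sum.cong) (auto simp: add_divide_distrib)
  also have "\<dots> = recip_sum A + 1 / of_nat x"
    using add assms(1) by (simp add: sum.distrib)
  finally show ?case by (simp add: recip_sum_def)
qed (simp add: recip_sum_def)

lemma add_submonoid_gen_recip_iff:
  "x \<in> add_submonoid_gen {1 / of_nat p | p. p \<in> P}
     \<longleftrightarrow> (\<exists>A. set_mset A \<subseteq> P \<and> x = recip_sum A)"
proof
  assume "x \<in> add_submonoid_gen {1 / of_nat p | p. p \<in> P}"
  then show "\<exists>A. set_mset A \<subseteq> P \<and> x = recip_sum A"
  proof induction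
    case zero
    show ?case by (rule exI[of _ "{#}"]) (simp add: recip_sum_def)
  next
    case (incl a)
    then obtain p where "p \<in> P" "a = 1 / of_nat p" by blast
    then show ?case by (intro exI[of _ "{#p#}"]) (simp add: recip_sum_def)
  next
    case (add x y)
    then obtain A B where "set_mset A \<subseteq> P" "x = recip_sum A" "set_mset B \<subseteq> P" "y = recip_sum B"
      by blast
    then show ?case by (intro exI[of _ "A + B"]) (simp add: recip_sum_add)
  qed
next
  assume "\<exists>A. set_mset A \<subseteq> P \<and> x = recip_sum A"
  then obtain A where "set_mset A \<subseteq> P" "x = recip_sum A" by blast
  then show "x \<in> add_submonoid_gen {1 / of_nat p | p. p \<in> P}"
    by (induction A arbitrary: x)
       (auto simp: recip_sum_def intro!: add_submonoid_gen.add intro: add_submonoid_gen.zero add_submonoid_gen.incl)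
qed

text \<open>After multiplication by the product of all primes involved, every term belonging to a
  prime other than \<open>p\<close> is divisible by \<open>p\<close>, while the cofactor of
  \<open>p\<close> itself is coprime to \<open>p\<close>. Hence \<open>p\<close> divides the
  difference of the two multiplicities.\<close>

lemma recip_sum_eq_imp_count_mod_eq:
  assumes eq: "recip_sum A = recip_sum B"
    and A: "\<forall>p\<in>#A. prime p" and B: "\<forall>p\<in>#B. prime p"
  shows "count A p mod p = count B p mod p"
proof (cases "p \<in># A + B")
  case True
  define F where "F = set_mset (A + B)"
  have F: "finite F" "p \<in> F" "\<And>q. q \<in> F \<Longrightarrow> prime q"
    using True A B by (auto simp: F_def)
  \<comment> \<open>\<open>d q\<close> is the product of all primes in \<open>F\<close> divided by
    \<open>q\<close>, the cofactor of \<open>q\<close> after clearing denominators.\<close>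
  define d where "d q = int (\<Prod>(F - {q}))" for q
  define u where "u q = int (count A q) - int (count B q)" for q
  have d: "rat_of_int (d q) = of_nat (\<Prod>F) / of_nat q" if "q \<in> F" for q
    using that F(1) F(3)[OF that] by (simp add: d_def prod.remove[of F q] prime_gt_0_nat)
  have "(\<Sum>q\<in>F. of_int (u q) / of_nat q) = (0 :: rat)"
    using eq recip_sum_altdef[of F A] recip_sum_altdef[of F B] F(1)
    by (simp add: u_def F_def sum_subtractf diff_divide_distrib)
  then have "of_nat (\<Prod>F) * (\<Sum>q\<in>F. of_int (u q) / of_nat q) = (0 :: rat)" by simp
  also have "of_nat (\<Prod>F) * (\<Sum>q\<in>F. of_int (u q) / of_nat q) = rat_of_int (\<Sum>q\<in>F. u q * d q)"
    by (simp add: sum_distrib_left d mult.commute)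
  finally have "(\<Sum>q\<in>F. u q * d q) = 0" by linarith
  then have "u p * d p = - (\<Sum>q\<in>F - {p}. u q * d q)"
    using F by (simp add: sum.remove[of F p])
  moreover have "int p dvd (\<Sum>q\<in>F - {p}. u q * d q)"
    using F by (intro dvd_sum dvd_mult) (auto simp: d_def simp del: of_nat_prod)
  ultimately have "int p dvd u p * d p" by simp
  moreover have "coprime (int p) (d p)"
    unfolding d_def using F by (auto intro!: prod_coprime_right primes_coprime)
  ultimately have "int p dvd u p"
    by (simp add: coprime_dvd_mult_left_iff)
  then show ?thesis
    unfolding u_def by (metis mod_eq_dvd_iff of_nat_eq_iff zmod_int)
next
  case False
  then show ?thesis by (simp add: not_in_iff)
qed

section \<open>Two numerical invariants of sums of reciprocals\<close>

definition quot_sum :: "nat multiset \<Rightarrow> nat" where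
  "quot_sum A = (\<Sum>p\<in>set_mset A. count A p div p)"

definition rem_sum :: "nat multiset \<Rightarrow> nat" where
  "rem_sum A = (\<Sum>p\<in>set_mset A. count A p mod p)"

lemma quot_sum_altdef:
  assumes "finite F" "set_mset A \<subseteq> F"
  shows "quot_sum A = (\<Sum>p\<in>F. count A p div p)"
  unfolding quot_sum_def using assms by (intro sum.mono_neutral_left) (auto simp: not_in_iff)

lemma rem_sum_altdef:
  assumes "finite F" "set_mset A \<subseteq> F"
  shows "rem_sum A = (\<Sum>p\<in>F. count A p mod p)"
  unfolding rem_sum_def using assms by (intro sum.mono_neutral_left) (auto simp: not_in_iff)

text \<open>Both numbers depend only on the value, not on its representation. The remainders agree
  prime by prime; subtracting their contribution from the common value leaves
  \<open>quot_sum\<close>.\<close>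

lemma recip_sum_eq_imp:
  assumes eq: "recip_sum A = recip_sum B"
    and A: "\<forall>p\<in>#A. prime p" and B: "\<forall>p\<in>#B. prime p"
  shows "quot_sum A = quot_sum B" "rem_sum A = rem_sum B"
proof -
  define F where "F = set_mset (A + B)"
  have F: "finite F" "set_mset A \<subseteq> F" "set_mset B \<subseteq> F" "\<And>q. q \<in> F \<Longrightarrow> prime q"
    using A B by (auto simp: F_def)
  note modeq = recip_sum_eq_imp_count_mod_eq[OF assms]
  show "rem_sum A = rem_sum B"
    using F modeq by (simp add: rem_sum_altdef[of F])
  have split: "recip_sum C = of_nat (quot_sum C) + (\<Sum>p\<in>F. of_nat (count C p mod p) / of_nat p)"
    if "set_mset C \<subseteq> F" for C
  proof -
    have "of_nat (count C p) / of_nat p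
        = (of_nat (count C p div p) + of_nat (count C p mod p) / of_nat p :: rat)" if "p \<in> F" for p
    proof -
      have "p > 0" using F(4)[OF that] by (simp add: prime_gt_0_nat)
      moreover have "rat_of_nat (count C p) = of_nat (count C p div p) * of_nat p + of_nat (count C p mod p)"
        by (metis div_mult_mod_eq of_nat_add of_nat_mult)
      ultimately show ?thesis by (simp add: field_simps)
    qed
    then show ?thesis
      using that F(1) by (simp add: recip_sum_altdef[of F] quot_sum_altdef[of F] sum.distrib)
  qed
  have "rat_of_nat (quot_sum A) = of_nat (quot_sum B)"
    using split[OF F(2)] split[OF F(3)] eq modeq by simp
  then show "quot_sum A = quot_sum B" by simp
qed

lemma quot_sum_add_ge: "quot_sum B \<le> quot_sum (B + U)"
proof -
  have "quot_sum B = (\<Sum>p\<in>set_mset (B + U). count B p div p)"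
    by (rule quot_sum_altdef) auto
  also have "\<dots> \<le> quot_sum (B + U)"
    unfolding quot_sum_def by (intro sum_mono) (simp add: div_le_mono)
  finally show ?thesis .
qed

text \<open>An unchanged \<open>quot_sum\<close> means that no prime produces a carry, so each
  remainder grows by the full multiplicity in \<open>U\<close>.\<close>

lemma rem_sum_add:
  assumes "quot_sum (B + U) = quot_sum B"
  shows "rem_sum (B + U) = rem_sum B + size U"
proof -
  define F where "F = set_mset (B + U)"
  have F: "finite F" "set_mset B \<subseteq> F" "set_mset U \<subseteq> F" "set_mset (B + U) \<subseteq> F"
    by (auto simp: F_def)
  have le: "count B p div p \<le> count (B + U) p div p" for p
    by (simp add: div_le_mono)
  have "(\<Sum>p\<in>F. count B p div p) = (\<Sum>p\<in>F. count (B + U) p div p)"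
    using assms F by (simp add: quot_sum_altdef[of F])
  \<comment> \<open>Termwise inequalities between two equal sums must be equalities.\<close>
  then have "count B p div p = count (B + U) p div p" if "p \<in> F" for p
    using sum_mono_inv[OF _ le that F(1)] by simp
  then have "count (B + U) p mod p = count B p mod p + count U p" if "p \<in> F" for p
    using that div_mult_mod_eq[of "count B p" p] div_mult_mod_eq[of "count (B + U) p" p]
    by (metis add_left_cancel add.assoc count_union)
  moreover have "size U = (\<Sum>p\<in>F. count U p)"
    unfolding size_multiset_overloaded_eq using F
    by (intro sum.mono_neutral_left) (auto simp: not_in_iff)
  ultimately show ?thesis
    using F by (simp add: rem_sum_altdef[of F] sum.distrib)
qed

lemma antitone_nat_eventually_const:
  fixes f :: "nat \<Rightarrow> nat"
  assumes "\<And>n. n \<ge> N \<Longrightarrow> f (Suc n) \<le> f n"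
  shows "\<exists>K\<ge>N. \<forall>n\<ge>K. f n = f K"
proof -
  obtain K where K: "K \<ge> N" "\<And>n. n \<ge> N \<Longrightarrow> f K \<le> f n"
    using ex_has_least_nat[of "\<lambda>n. n \<ge> N" N f] by auto
  have "f n \<le> f K" if "n \<ge> K" for n
    using that
  proof (induction n rule: dec_induct)
    case (step n)
    then show ?case using assms[of n] K(1) by linarith
  qed simp
  then have "f n = f K" if "n \<ge> K" for n
    using that K by (meson order.antisym order.trans)
  with K(1) show ?thesis by blast
qed

text \<open>Lexicographic descent: \<open>quot_sum\<close> becomes constant first, and from then on
  \<open>rem_sum\<close> drops by the size of the multiset representing \<open>m n\<close>, which is
  therefore eventually empty. The start index \<open>N\<close> is there because the multiplicative
  chain yields exponents only from some point on.\<close>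

lemma recip_monoid_chain:
  assumes P: "\<forall>p\<in>P. prime p"
  defines "M \<equiv> add_submonoid_gen {1 / of_nat p | p. p \<in> P} :: rat set"
  assumes a: "\<And>n. n \<ge> N \<Longrightarrow> a n \<in> M" and m: "\<And>n. n \<ge> N \<Longrightarrow> m n \<in> M"
    and chain: "\<And>n. n \<ge> N \<Longrightarrow> a n = a (Suc n) + m n"
  shows "\<exists>K\<ge>N. \<forall>n\<ge>K. m n = 0"
proof -
  have "\<exists>A. \<forall>n\<ge>N. set_mset (A n) \<subseteq> P \<and> a n = recip_sum (A n)"
    using a unfolding M_def add_submonoid_gen_recip_iff by metis
  then obtain A where A: "\<And>n. n \<ge> N \<Longrightarrow> set_mset (A n) \<subseteq> P \<and> a n = recip_sum (A n)" by blast
  have "\<exists>U. \<forall>n\<ge>N. set_mset (U n) \<subseteq> P \<and> m n = recip_sum (U n)"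
    using m unfolding M_def add_submonoid_gen_recip_iff by metis
  then obtain U where U: "\<And>n. n \<ge> N \<Longrightarrow> set_mset (U n) \<subseteq> P \<and> m n = recip_sum (U n)" by blast
  have step: "quot_sum (A n) = quot_sum (A (Suc n) + U n)" "rem_sum (A n) = rem_sum (A (Suc n) + U n)"
    if n: "n \<ge> N" for n
  proof -
    have "recip_sum (A n) = recip_sum (A (Suc n) + U n)"
      using chain[OF n] A[OF n] A[of "Suc n"] U[OF n] n by (simp add: recip_sum_add)
    moreover have "\<forall>p\<in>#A n. prime p" "\<forall>p\<in>#A (Suc n) + U n. prime p"
      using P A[OF n] A[of "Suc n"] U[OF n] n by auto
    ultimately show "quot_sum (A n) = quot_sum (A (Suc n) + U n)"
      "rem_sum (A n) = rem_sum (A (Suc n) + U n)"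
      by (rule recip_sum_eq_imp)+
  qed
  obtain K where K: "K \<ge> N" "\<And>n. n \<ge> K \<Longrightarrow> quot_sum (A n) = quot_sum (A K)"
    using antitone_nat_eventually_const[of N "\<lambda>n. quot_sum (A n)"] step(1) quot_sum_add_ge by metis
  have rem: "rem_sum (A n) = rem_sum (A (Suc n)) + size (U n)" if "n \<ge> K" for n
  proof -
    have "quot_sum (A (Suc n) + U n) = quot_sum (A (Suc n))"
      using K(2)[of n] K(2)[of "Suc n"] step(1)[of n] that K(1) by simp
    then show ?thesis using rem_sum_add step(2)[of n] that K(1) by simp
  qed
  obtain K' where K': "K' \<ge> K" "\<And>n. n \<ge> K' \<Longrightarrow> rem_sum (A n) = rem_sum (A K')"
    using antitone_nat_eventually_const[of K "\<lambda>n. rem_sum (A n)"] rem by (metis le_add1)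
  have "m n = 0" if "n \<ge> K'" for n
  proof -
    have "size (U n) = 0" using rem[of n] K'(2)[of n] K'(2)[of "Suc n"] that K'(1) by simp
    then show ?thesis using U[of n] that K'(1) K(1) by (simp add: recip_sum_def)
  qed
  then show ?thesis using K'(1) K(1) order_trans by blast
qed

section \<open>Sums of exponentials\<close>

definition exp_sum :: "rat multiset \<Rightarrow> real" where
  "exp_sum A = (\<Sum>a\<in>#A. exp (real_of_rat a))"

lemma exp_sum_add: "exp_sum (A + B) = exp_sum A + exp_sum B"
  by (simp add: exp_sum_def)

lemma exp_sum_shift: "exp_sum (image_mset ((+) c) A) = exp (real_of_rat c) * exp_sum A"
  by (simp add: exp_sum_def of_rat_add exp_add sum_mset_distrib_left image_mset.compositionality o_def)

lemma exp_semiring_iff: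
  "x \<in> exp_semiring (real_of_rat ` M) \<longleftrightarrow> (\<exists>A. set_mset A \<subseteq> M \<and> x = exp_sum A)"
proof
  assume "x \<in> exp_semiring (real_of_rat ` M)"
  then show "\<exists>A. set_mset A \<subseteq> M \<and> x = exp_sum A"
    unfolding exp_semiring_def
  proof induction
    case zero
    show ?case by (rule exI[of _ "{#}"]) (simp add: exp_sum_def)
  next
    case (incl e)
    then obtain a where "a \<in> M" "e = exp (real_of_rat a)" by blast
    then show ?case by (intro exI[of _ "{#a#}"]) (simp add: exp_sum_def)
  next
    case (add x y)
    then obtain A B where "set_mset A \<subseteq> M" "x = exp_sum A" "set_mset B \<subseteq> M" "y = exp_sum B"
      by blast
    then show ?case by (intro exI[of _ "A + B"]) (simp add: exp_sum_add)
  qed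
next
  assume "\<exists>A. set_mset A \<subseteq> M \<and> x = exp_sum A"
  then obtain A where "set_mset A \<subseteq> M" "x = exp_sum A" by blast
  then show "x \<in> exp_semiring (real_of_rat ` M)"
    unfolding exp_semiring_def
    by (induction A arbitrary: x)
       (auto simp: exp_sum_def intro!: add_submonoid_gen.add intro: add_submonoid_gen.zero add_submonoid_gen.incl)
qed

section \<open>Uniqueness of the exponents of a sum of exponentials\<close>

lemma common_denominator:
  fixes A :: "rat multiset"
  shows "\<exists>N>0. \<forall>a\<in>#A. a * of_nat N \<in> \<int>"
proof (induction A)
  case (add a A)
  then obtain N where N: "N > 0" "\<forall>a\<in>#A. a * of_nat N \<in> \<int>" by blast
  obtain u v :: int where uv: "a = of_int u / of_int v" "v > 0"
    by (metis Fract_of_int_quotient Rat_cases)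
  then have "a * of_nat (N * nat v) = of_int (u * int N)" by simp
  then have "a * of_nat (N * nat v) \<in> \<int>" by (metis Ints_of_int)
  moreover have "b * of_nat (N * nat v) \<in> \<int>" if "b \<in># A" for b
    using Ints_mult[OF bspec[OF N(2) that] Ints_of_nat[of "nat v"]] by (simp add: mult.assoc)
  ultimately show ?case using N(1) uv(2) by (intro exI[of _ "N * nat v"]) auto
qed auto

text \<open>The generating polynomial of a multiset of naturals; its value at
  \<open>exp (1 / N)\<close> is the sum of the exponentials of the \<open>k / N\<close>.\<close>

definition exponent_poly :: "nat multiset \<Rightarrow> int poly" where
  "exponent_poly A = (\<Sum>k\<in>#A. monom 1 k)"

lemma coeff_exponent_poly: "coeff (exponent_poly A) k = int (count A k)"
  by (induction A) (auto simp: exponent_poly_def)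

lemma poly_exponent_poly:
  "poly (real_poly (exponent_poly A)) (exp (1 / real N)) = (\<Sum>k\<in>#A. exp (real k / real N))"
proof (induction A)
  case (add k A)
  have "real_poly (monom 1 k + exponent_poly A) = monom 1 k + real_poly (exponent_poly A)"
    by (rule poly_eqI) (simp add: coeff_map_poly)
  then show ?case
    using add by (simp add: exponent_poly_def poly_monom flip: exp_of_nat_mult)
qed (simp add: exponent_poly_def)

text \<open>With a common denominator \<open>N\<close>, both sums are values of generating
  polynomials at the transcendental number \<open>exp (1 / N)\<close>, so these polynomials
  coincide. Nonnegativity makes the scaled exponents natural numbers.\<close>

lemma exp_sum_inject:
  assumes eq: "exp_sum A = exp_sum B" and nonneg: "\<forall>a\<in>#A. 0 \<le> a" "\<forall>b\<in>#B. 0 \<le> b"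
  shows "A = B"
proof -
  obtain N where N: "N > 0" "\<forall>a\<in>#A + B. a * of_nat N \<in> \<int>"
    using common_denominator by blast
  define f where "f a = nat \<lfloor>a * of_nat N\<rfloor>" for a :: rat
  have f: "of_nat (f a) / of_nat N = a" if "a \<in># A + B" for a
  proof -
    have "a * of_nat N \<in> \<int>" "0 \<le> a * of_nat N" using that N nonneg by auto
    then have "of_nat (f a) = a * of_nat N" unfolding f_def
      by (elim Ints_cases) simp
    then show ?thesis using N(1) by simp
  qed
  \<comment> \<open>Scaling by \<open>N\<close> loses nothing on the exponents at hand, so equality
    of the scaled multisets can be carried back to \<open>A\<close> and \<open>B\<close>.\<close>
  have inv: "image_mset (\<lambda>k. of_nat k / of_nat N) (image_mset f C) = C" if "C \<subseteq># A + B" for C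
  proof -
    have "image_mset (\<lambda>a. of_nat (f a) / of_nat N) C = image_mset (\<lambda>a. a) C"
      using that f by (intro image_mset_cong) (auto dest: mset_subset_eqD)
    then show ?thesis by (simp add: image_mset.compositionality o_def)
  qed
  have ev: "poly (real_poly (exponent_poly (image_mset f C))) (exp (1 / real N)) = exp_sum C"
    if "C \<subseteq># A + B" for C
  proof -
    have "exp_sum C = exp_sum (image_mset (\<lambda>k. of_nat k / of_nat N) (image_mset f C))"
      using inv[OF that] by simp
    also have "\<dots> = (\<Sum>k\<in>#image_mset f C. exp (real k / real N))"
      by (simp add: exp_sum_def of_rat_divide image_mset.compositionality o_def)
    finally show ?thesis by (simp add: poly_exponent_poly)
  qed
  let ?q = "exponent_poly (image_mset f A) - exponent_poly (image_mset f B)"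
  have "poly (real_poly ?q) (exp (1 / real N)) = 0"
    using eq by (simp add: real_poly_diff ev)
  then have "?q = 0" using exp_inverse_nat_transcendental[OF N(1)] by blast
  then have "exponent_poly (image_mset f A) = exponent_poly (image_mset f B)" by simp
  then have "int (count (image_mset f A) k) = int (count (image_mset f B) k)" for k
    by (simp only: flip: coeff_exponent_poly)
  then have "image_mset f A = image_mset f B"
    by (intro multiset_eqI) (simp only: of_nat_eq_iff)
  then have "image_mset (\<lambda>k. of_nat k / of_nat N :: rat) (image_mset f A)
      = image_mset (\<lambda>k. of_nat k / of_nat N) (image_mset f B)" by (rule arg_cong)
  then show ?thesis
    using inv[OF mset_subset_eq_add_left] inv[OF mset_subset_eq_add_right] by (rule box_equals)
qed

lemma size_le_exp_sum:
  assumes "\<forall>a\<in>#A. 0 \<le> a"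
  shows "real (size A) \<le> exp_sum A"
  using assms
proof (induction A)
  case (add a A)
  have "1 \<le> exp (real_of_rat a)" using add.prems by simp
  moreover have "real (size A) \<le> exp_sum A" using add by simp
  moreover have "exp_sum (add_mset a A) = exp (real_of_rat a) + exp_sum A" by (simp add: exp_sum_def)
  moreover have "real (size (add_mset a A)) = 1 + real (size A)" by simp
  ultimately show ?case by linarith
qed (simp add: exp_sum_def)

section \<open>The ascending chain condition for both monoids\<close>

text \<open>Inclusions of principal ideals become divisibility of chosen generators. Once all
  quotients \<open>y n\<close> are the identity, the generators, and with them the ideals, are
  constant.\<close>

lemma ACCP_I:
  assumes "monoid G"
    and chain: "\<And>x y. (\<And>n. x n \<in> carrier G) \<Longrightarrow> (\<And>n. y n \<in> carrier G)
      \<Longrightarrow> (\<And>n. x n = x (Suc n) \<otimes>\<^bsub>G\<^esub> y n) \<Longrightarrow> \<exists>N. \<forall>n\<ge>N. y n = \<one>\<^bsub>G\<^esub>"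
  shows "ACCP G"
  unfolding ACCP_def
proof (intro allI impI)
  interpret monoid G by fact
  fix I :: "nat \<Rightarrow> 'a set"
  assume "\<forall>n. \<exists>x\<in>carrier G. I n = principal_ideal G x" and sub: "\<forall>n. I n \<subseteq> I (Suc n)"
  then obtain x where x: "\<And>n. x n \<in> carrier G" "\<And>n. I n = principal_ideal G (x n)" by metis
  have "x n \<in> I n" for n
    using x(1)[of n] by (auto simp: x(2) principal_ideal_def intro!: exI[of _ "\<one>\<^bsub>G\<^esub>"])
  then have "\<exists>y. y \<in> carrier G \<and> x n = x (Suc n) \<otimes>\<^bsub>G\<^esub> y" for n
    using sub x(2)[of "Suc n"] unfolding principal_ideal_def by blast
  then obtain y where y: "\<And>n. y n \<in> carrier G" "\<And>n. x n = x (Suc n) \<otimes>\<^bsub>G\<^esub> y n" by metis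
  obtain N where N: "\<And>n. n \<ge> N \<Longrightarrow> y n = \<one>\<^bsub>G\<^esub>" using chain[of x y, OF x(1) y] by blast
  have "x n = x N" if "n \<ge> N" for n
    using that
  proof (induction n rule: dec_induct)
    case (step n)
    then show ?case using N[of n] x(1)[of "Suc n"] y(2)[of n] by simp
  qed simp
  then show "\<exists>N. \<forall>n\<ge>N. I n = I N" using x(2) by metis
qed

text \<open>The floors form a nonincreasing sequence of naturals and become constant; two reals with
  the same floor differ by less than 1.\<close>

lemma eventually_small_decrement:
  fixes x :: "nat \<Rightarrow> real"
  assumes "\<And>n. 0 \<le> x n" and "\<And>n. x (Suc n) \<le> x n"
  shows "\<exists>N. \<forall>n\<ge>N. x n - x (Suc n) < 1"
proof -
  have "nat \<lfloor>x (Suc n)\<rfloor> \<le> nat \<lfloor>x n\<rfloor>" for n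
    using assms(2) by (intro nat_mono floor_mono)
  then obtain N where N: "\<And>n. n \<ge> N \<Longrightarrow> nat \<lfloor>x n\<rfloor> = nat \<lfloor>x N\<rfloor>"
    using antitone_nat_eventually_const[of 0 "\<lambda>n. nat \<lfloor>x n\<rfloor>"] by auto
  have "x n - x (Suc n) < 1" if "n \<ge> N" for n
  proof -
    have "\<lfloor>x n\<rfloor> = \<lfloor>x (Suc n)\<rfloor>"
      using N[of n] N[of "Suc n"] that assms(1) by (simp add: nat_eq_iff)
    then show ?thesis by linarith
  qed
  then show ?thesis by blast
qed

lemma exp_semiring_0_or_ge_1:
  assumes "\<forall>a\<in>M. 0 \<le> a" and x: "x \<in> exp_semiring (real_of_rat ` M)"
  shows "x = 0 \<or> 1 \<le> x"
proof -
  obtain A where A: "set_mset A \<subseteq> M" "x = exp_sum A" using x exp_semiring_iff by blast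
  show ?thesis
  proof (cases "A = {#}")
    case False
    then have "1 \<le> real (size A)" by (simp add: Suc_le_eq nonempty_has_size)
    then show ?thesis using size_le_exp_sum[of A] A assms(1) by force
  qed (simp add: A exp_sum_def)
qed

text \<open>The increments \<open>y n\<close> are eventually below 1, and the semiring has no
  element strictly between 0 and 1.\<close>

lemma ACCP_additive_exp_semiring:
  assumes M: "0 \<in> M" "\<And>a b. a \<in> M \<Longrightarrow> b \<in> M \<Longrightarrow> a + b \<in> M" "\<forall>a\<in>M. 0 \<le> a"
  shows "ACCP (additive_monoid (exp_semiring (real_of_rat ` M)))"
proof (rule ACCP_I)
  let ?S = "exp_semiring (real_of_rat ` M)"
  have S: "positive_semiring ?S"
    using M by (intro positive_semiring_exp_semiring) (auto simp flip: of_rat_add)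
  interpret comm_monoid_cancel "additive_monoid ?S"
    using S by (rule comm_monoid_cancel_additive_monoid)
  show "monoid (additive_monoid ?S)" ..
  fix x y :: "nat \<Rightarrow> real"
  assume X: "\<And>n. x n \<in> carrier (additive_monoid ?S)"
    and Y: "\<And>n. y n \<in> carrier (additive_monoid ?S)"
    and XY: "\<And>n. x n = x (Suc n) \<otimes>\<^bsub>additive_monoid ?S\<^esub> y n"
  have xy: "x n \<in> ?S" "y n \<in> ?S" "x n = x (Suc n) + y n" for n
    using X[of n] Y[of n] XY[of n] by (simp_all add: additive_monoid_def)
  have nonneg: "0 \<le> x n" "0 \<le> y n" for n
    using xy(1,2)[of n] S by (auto simp: positive_semiring_def)
  have "x (Suc n) \<le> x n" for n
    using nonneg(2)[of n] xy(3)[of n] by simp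
  with nonneg(1) have "\<exists>N. \<forall>n\<ge>N. x n - x (Suc n) < 1"
    by (rule eventually_small_decrement)
  then obtain N where N: "\<And>n. n \<ge> N \<Longrightarrow> x n - x (Suc n) < 1" by blast
  have "y n = 0" if "n \<ge> N" for n
    using N[OF that] xy(3)[of n] exp_semiring_0_or_ge_1[OF M(3) xy(2)[of n]] by linarith
  then show "\<exists>N. \<forall>n\<ge>N. y n = \<one>\<^bsub>additive_monoid ?S\<^esub>"
    by (auto simp: additive_monoid_def)
qed

lemma sum_mset_in_submonoid:
  assumes "0 \<in> M" "\<And>a b. a \<in> M \<Longrightarrow> b \<in> M \<Longrightarrow> a + b \<in> M" "set_mset A \<subseteq> M"
  shows "sum_mset A \<in> M"
  using assms(3) by (induction A) (auto intro: assms)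

text \<open>Adding up exponents turns a tail of a chain in the semiring into a chain in
  \<open>M\<close>, to which the hypothesis \<open>M_chain\<close> applies.\<close>

lemma ACCP_multiplicative_exp_semiring:
  fixes M :: "rat set"
  assumes M: "0 \<in> M" "\<And>a b. a \<in> M \<Longrightarrow> b \<in> M \<Longrightarrow> a + b \<in> M" "\<forall>a\<in>M. 0 \<le> a"
    and M_chain: "\<And>N a m. (\<And>n. n \<ge> N \<Longrightarrow> a n \<in> M) \<Longrightarrow> (\<And>n. n \<ge> N \<Longrightarrow> m n \<in> M) \<Longrightarrow>
      (\<And>n. n \<ge> N \<Longrightarrow> a n = a (Suc n) + m n) \<Longrightarrow> \<exists>K\<ge>N. \<forall>n\<ge>K. m n = 0"
  shows "ACCP (multiplicative_monoid (exp_semiring (real_of_rat ` M)))"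
proof (rule ACCP_I)
  let ?S = "exp_semiring (real_of_rat ` M)"
  have S: "positive_semiring ?S"
    using M by (intro positive_semiring_exp_semiring) (auto simp flip: of_rat_add)
  interpret comm_monoid_cancel "multiplicative_monoid ?S"
    using S by (rule comm_monoid_cancel_multiplicative_monoid)
  show "monoid (multiplicative_monoid ?S)" ..
  fix x y :: "nat \<Rightarrow> real"
  assume X: "\<And>n. x n \<in> carrier (multiplicative_monoid ?S)"
    and Y: "\<And>n. y n \<in> carrier (multiplicative_monoid ?S)"
    and XY: "\<And>n. x n = x (Suc n) \<otimes>\<^bsub>multiplicative_monoid ?S\<^esub> y n"
  have xy: "x n \<in> ?S" "y n \<in> ?S" "x n = x (Suc n) * y n" for n
    using X[of n] Y[of n] XY[of n] by (simp_all add: multiplicative_monoid_def)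
  have nz: "x n \<noteq> 0" "y n \<noteq> 0" for n
    using X[of n] Y[of n] by (simp_all add: multiplicative_monoid_def)
  have ge1: "1 \<le> x n" "1 \<le> y n" for n
    using exp_semiring_0_or_ge_1[OF M(3) xy(1)[of n]] exp_semiring_0_or_ge_1[OF M(3) xy(2)[of n]] nz[of n]
    by auto
  have "x (Suc n) \<le> x n" for n
    using ge1[of "Suc n"] ge1(2)[of n] xy(3)[of n] by simp
  then have "\<exists>N. \<forall>n\<ge>N. x n - x (Suc n) < 1"
    using order_trans[OF zero_le_one ge1(1)] by (intro eventually_small_decrement)
  then obtain N where N: "\<And>n. n \<ge> N \<Longrightarrow> x n - x (Suc n) < 1" by blast
  \<comment> \<open>A quotient of at least 2 would lower the chain by at least
    \<open>x (Suc n) \<ge> 1\<close>.\<close>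
  have lt2: "y n < 2" if "n \<ge> N" for n
  proof (rule ccontr)
    assume "\<not> y n < 2"
    then have "x (Suc n) * 2 \<le> x (Suc n) * y n"
      using ge1(1)[of "Suc n"] by (intro mult_left_mono) auto
    also have "\<dots> = x n" by (rule xy(3) [symmetric])
    finally have "x (Suc n) * 2 \<le> x n" .
    then show False using N[OF that] ge1(1)[of "Suc n"] by linarith
  qed
  \<comment> \<open>Every exponential in the sum is at least 1, so a nonzero sum below 2 has exactly
    one term.\<close>
  have "\<exists>m\<in>M. y n = exp (real_of_rat m)" if n: "n \<ge> N" for n
  proof -
    obtain B where B: "set_mset B \<subseteq> M" "y n = exp_sum B" using xy(2) exp_semiring_iff by blast
    have "real (size B) < 2" using size_le_exp_sum[of B] B M(3) lt2[OF n] by force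
    moreover have "B \<noteq> {#}" using nz(2)[of n] B(2) by (auto simp: exp_sum_def)
    ultimately have "size B = 1" by (simp add: nonempty_has_size less_2_cases_iff)
    then obtain m where "B = {#m#}" using size_1_singleton_mset by blast
    then show ?thesis using B by (auto simp: exp_sum_def)
  qed
  then obtain m where m: "\<And>n. n \<ge> N \<Longrightarrow> m n \<in> M" "\<And>n. n \<ge> N \<Longrightarrow> y n = exp (real_of_rat (m n))"
    by metis
  have "\<forall>n. \<exists>A. set_mset A \<subseteq> M \<and> x n = exp_sum A"
    using xy(1) exp_semiring_iff by blast
  then obtain A where A: "\<And>n. set_mset (A n) \<subseteq> M" "\<And>n. x n = exp_sum (A n)"
    by (auto dest!: choice)
  have step: "A n = image_mset ((+) (m n)) (A (Suc n))" if n: "n \<ge> N" for n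
  proof (rule exp_sum_inject)
    show "exp_sum (A n) = exp_sum (image_mset ((+) (m n)) (A (Suc n)))"
      using xy(3)[of n] A(2) m(2)[OF n] by (simp add: exp_sum_shift mult.commute)
    show "\<forall>a\<in>#A n. 0 \<le> a" "\<forall>b\<in>#image_mset ((+) (m n)) (A (Suc n)). 0 \<le> b"
      using A(1) M(3) m(1)[OF n] by (auto intro!: add_nonneg_nonneg)
  qed
  \<comment> \<open>The total exponent drops by \<open>m n\<close> once for each term of
    \<open>x (Suc n)\<close>. There is at least one such term, so \<open>?d n = 0\<close> forces
    \<open>m n = 0\<close>.\<close>
  let ?d = "\<lambda>n. sum_mset (image_mset (\<lambda>_. m n) (A (Suc n)))"
  have "\<exists>K\<ge>N. \<forall>n\<ge>K. ?d n = 0"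
  proof (rule M_chain)
    fix n assume n: "n \<ge> N"
    show "sum_mset (A n) \<in> M" using A(1) M by (intro sum_mset_in_submonoid)
    show "?d n \<in> M" using m(1)[OF n] M by (intro sum_mset_in_submonoid) auto
    show "sum_mset (A n) = sum_mset (A (Suc n)) + ?d n"
      by (subst step[OF n]) (simp add: sum_mset.distrib add.commute)
  qed
  then obtain K where K: "K \<ge> N" "\<And>n. n \<ge> K \<Longrightarrow> ?d n = 0" by blast
  have "y n = 1" if n: "n \<ge> K" for n
  proof -
    have "A (Suc n) \<noteq> {#}" using nz(1)[of "Suc n"] A(2)[of "Suc n"] by (auto simp: exp_sum_def)
    then have "m n = 0" using K(2)[OF n] by simp
    then show ?thesis using m(2)[of n] K(1) n by simp
  qed
  then show "\<exists>N. \<forall>n\<ge>N. y n = \<one>\<^bsub>multiplicative_monoid ?S\<^esub>"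
    by (auto simp: multiplicative_monoid_def)
qed

theorem proposition4p1:
  fixes P :: "nat set"
  assumes "P \<noteq> {}" and "\<forall>p \<in> P. prime p"
  shows "bi_ACCP (exp_semiring (real_of_rat ` add_submonoid_gen {1 / of_nat p | p. p \<in> P}))"
proof -
  let ?M = "add_submonoid_gen {1 / of_nat p | p. p \<in> P} :: rat set"
  have M: "0 \<in> ?M" "\<And>a b. a \<in> ?M \<Longrightarrow> b \<in> ?M \<Longrightarrow> a + b \<in> ?M" "\<forall>a\<in>?M. 0 \<le> a"
    by (auto intro: add_submonoid_gen.zero add_submonoid_gen.add elim!: add_submonoid_gen_nonneg)
  show ?thesis
    unfolding bi_ACCP_def
  proof
    show "ACCP (additive_monoid (exp_semiring (real_of_rat ` ?M)))"
      using M by (rule ACCP_additive_exp_semiring)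
    show "ACCP (multiplicative_monoid (exp_semiring (real_of_rat ` ?M)))"
      using M recip_monoid_chain[OF assms(2)] by (rule ACCP_multiplicative_exp_semiring)
  qed
qed

end
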